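(* Let $n\ge 1$, and let $v_n,t,\xi_0,\xi_1^{(n)},\Phi_n,\lambda_n,U_0,U_1$ be as defined in the context. (a) The morphism $\varphi_0=(t,\xi_0)$, respectively $\varphi_1^{(n)}=(t,\xi_1^{(n)})$, yields a local trivialization of the family $\lambda_n$ over $U_0$, respectively over $U_1$; that is, $(\Phi_n,\varphi_0):\Phi_n^{-1}(U_0)\to U_0\times\mathbb{A}^2_{\mathbb{C}}$ and $(\Phi_n,\varphi_1^{(n)}):\Phi_n^{-1}(U_1)\to U_1\times\mathbb{A}^2_{\mathbb{C}}$ are isomorphisms. Thus $\lambda_n$ is an algebraic fiber bundle with $\mathbb{A}^2_{\mathbb{C}}$ as the typical fiber. (b) The transition function $\varphi_{10}^{(n)}=\varphi_1^{(n)}\circ\varphi_0^{-1}:(t,\xi_0)\longmapsto(t,\xi_1^{(n)})$ over $U_0\cap U_1$ is a triangular automorphism with $$\xi_1^{(n)}=\xi_0+\frac{p_n(t)}{x^kv_n^l},\qquad (k,l)=\begin{cases}(3,2),& n\ge 2\\ (3,3),& n=1,\end{cases}$$ where the polynomials $p_n\in\mathbb{C}[x,v_n,t]$ are given by $$p_n(t)=\begin{cases} v_nt^2-x^2t,& n\ge 3\\ x^2t^3+v_2t^2-x^2t,& n=2\\ x^2t^4+xv_1t^3+v_1^2t^2-x^2v_1t,& n=1.\end{cases}$$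
   Context: In $\mathbb{C}[x,y,z,u]$ put $$w=z^2+yu,\quad t=xz+yw,\quad s=-(2xz+yw)w,\quad \eta=s+x^2u=x^2u-2xzw-yw^2,$$ and let $v_n=y+x^nt$ ($n\ge1$) be the Vénéreau polynomials. Put $$\zeta^{(1)}=-v_1z+v_1t(v_1u+z^2+w)+t^2(xz^2+st),$$ $$\zeta^{(2)}=-z+xt(v_2u+z^2+st+w),$$ $$\zeta^{(n)}=-z+x^{n-3}t\,(v_n\eta+x^2w)\quad (n\ge 3),$$ and define the rational functions $\xi_0=\eta/x^3$, $\xi_1^{(1)}=\zeta^{(1)}/v_1^3$, and $\xi_1^{(n)}=\zeta^{(n)}/v_n^2$ for $n\ge 2$. Let $\Phi_n=(v_n,x):\mathbb{A}^4_{\mathbb{C}}=\operatorname{Spec}\mathbb{C}[x,y,z,u]\to\mathbb{A}^2_{\mathbb{C}}=\operatorname{Spec}\mathbb{C}[x,v_n]$. The fiber of $\Phi_n$ over the origin $\bar 0$ is the coordinate $(z,u)$-plane $\{x=y=0\}\cong\mathbb{A}^2_{\mathbb{C}}\subseteq\mathbb{A}^4_{\mathbb{C}}$, and $\lambda_n$ denotes the restriction $\lambda_n=\Phi_n|:\mathbb{A}^4_{\mathbb{C}}\setminus\mathbb{A}^2_{\mathbb{C}}\to\mathbb{A}^2_{\mathbb{C}}\setminus\{\bar 0\}$ over the punctured plane. The punctured plane is covered by the open sets $U_0=\operatorname{Spec}\mathbb{C}[x,x^{-1},v_n]=\{x\ne0\}$ and $U_1=\operatorname{Spec}\mathbb{C}[x,v_n,v_n^{-1}]=\{v_n\neq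 0\}$. An algebraic fiber bundle with typical fiber $\mathbb{A}^2_{\mathbb{C}}$ is a morphism that is Zariski-locally on the base isomorphic, over the base, to the projection of a product with $\mathbb{A}^2_{\mathbb{C}}$. *)

theory Defs
  imports "HOL-Analysis.Analysis"
begin

text \<open>
  Varieties over the complex numbers are taken in the classical sense, through their closed
  points: affine \<open>n\<close>-space is \<open>complex ^ 'n\<close> with the Zariski topology (not the Euclidean one),
  and its coordinate ring is the ring of polynomial functions.
\<close>

inductive poly_fun :: "(complex ^ 'n \<Rightarrow> complex) \<Rightarrow> bool" where
  const: "poly_fun (\<lambda>_. c)"
| coord: "poly_fun (\<lambda>p. p $ i)"
| add: "poly_fun f \<Longrightarrow> poly_fun g \<Longrightarrow> poly_fun (\<lambda>p. f p + g p)"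
| mult: "poly_fun f \<Longrightarrow> poly_fun g \<Longrightarrow> poly_fun (\<lambda>p. f p * g p)"

definition zariski_closed :: "(complex ^ 'n) set \<Rightarrow> bool" where
  "zariski_closed C \<longleftrightarrow> (\<exists>S. (\<forall>f\<in>S. poly_fun f) \<and> C = {p. \<forall>f\<in>S. f p = 0})"

definition zariski_openin :: "(complex ^ 'n) set \<Rightarrow> (complex ^ 'n) set \<Rightarrow> bool" where
  "zariski_openin X U \<longleftrightarrow> (\<exists>C. zariski_closed C \<and> U = X - C)"

definition quasi_affine :: "(complex ^ 'n) set \<Rightarrow> bool" where
  "quasi_affine X \<longleftrightarrow> (\<exists>C. zariski_closed C \<and> zariski_openin C X)"

definition regular_on :: "(complex ^ 'n) set \<Rightarrow> (complex ^ 'n \<Rightarrow> complex) \<Rightarrow> bool" where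
  "regular_on X f \<longleftrightarrow>
     (\<forall>p\<in>X. \<exists>U g h. zariski_openin X U \<and> p \<in> U \<and> poly_fun g \<and> poly_fun h \<and>
        (\<forall>q\<in>U. h q \<noteq> 0 \<and> f q = g q / h q))"

text \<open>Morphisms are total functions of which only the values on \<open>X\<close> matter.\<close>

definition variety_morphism ::
  "(complex ^ 'n) set \<Rightarrow> (complex ^ 'm) set \<Rightarrow> (complex ^ 'n \<Rightarrow> complex ^ 'm) \<Rightarrow> bool" where
  "variety_morphism X Y f \<longleftrightarrow> quasi_affine X \<and> quasi_affine Y \<and>
     f ` X \<subseteq> Y \<and> (\<forall>i. regular_on X (\<lambda>p. f p $ i))"

definition variety_iso ::
  "(complex ^ 'n) set \<Rightarrow> (complex ^ 'm) set \<Rightarrow> (complex ^ 'n \<Rightarrow> complex ^ 'm) \<Rightarrow> bool" where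
  "variety_iso X Y f \<longleftrightarrow> variety_morphism X Y f \<and>
     (\<exists>g. variety_morphism Y X g \<and> (\<forall>p\<in>X. g (f p) = p) \<and> (\<forall>q\<in>Y. f (g q) = q))"

definition vpair :: "complex ^ 'n \<Rightarrow> complex ^ 'm \<Rightarrow> complex ^ ('n + 'm)" where
  "vpair a b = (\<chi> i. case i of Inl j \<Rightarrow> a $ j | Inr j \<Rightarrow> b $ j)"

definition vprod ::
  "(complex ^ 'n) set \<Rightarrow> (complex ^ 'm) set \<Rightarrow> (complex ^ ('n + 'm)) set" where
  "vprod X Y = {vpair a b |a b. a \<in> X \<and> b \<in> Y}"

text \<open>
  An isomorphism onto \<open>V \<times> F\<close> over \<open>V\<close> is a pair \<open>(\<pi>, \<phi>)\<close>, so it is given by its fiber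
  component \<open>\<phi>\<close>.
\<close>

definition local_trivialization ::
  "(complex ^ 'n) set \<Rightarrow> (complex ^ 'b) set \<Rightarrow> (complex ^ 'n \<Rightarrow> complex ^ 'b) \<Rightarrow>
   (complex ^ 'f) set \<Rightarrow> (complex ^ 'b) set \<Rightarrow> (complex ^ 'n \<Rightarrow> complex ^ 'f) \<Rightarrow> bool" where
  "local_trivialization E B \<pi> F V \<phi> \<longleftrightarrow> zariski_openin B V \<and>
     variety_iso (E \<inter> \<pi> -` V) (vprod V F) (\<lambda>p. vpair (\<pi> p) (\<phi> p))"

definition algebraic_fiber_bundle ::
  "(complex ^ 'n) set \<Rightarrow> (complex ^ 'b) set \<Rightarrow> (complex ^ 'n \<Rightarrow> complex ^ 'b) \<Rightarrow>
   (complex ^ 'f) set \<Rightarrow> bool" where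
  "algebraic_fiber_bundle E B \<pi> F \<longleftrightarrow> variety_morphism E B \<pi> \<and>
     (\<forall>b\<in>B. \<exists>V \<phi>. b \<in> V \<and> local_trivialization E B \<pi> F V \<phi>)"

text \<open>
  The transition function \<open>(\<pi>, \<psi>) \<circ> (\<pi>, \<phi>)\<^sup>-\<^sup>1\<close> over \<open>V\<close>, including the base component;
  meaningful on \<open>V \<times> F\<close> when \<open>(\<pi>, \<phi>)\<close> is a bijection onto it.
\<close>

definition transition_function ::
  "(complex ^ 'n) set \<Rightarrow> (complex ^ 'n \<Rightarrow> complex ^ 'b) \<Rightarrow> (complex ^ 'b) set \<Rightarrow>
   (complex ^ 'n \<Rightarrow> complex ^ 'f) \<Rightarrow> (complex ^ 'n \<Rightarrow> complex ^ 'f) \<Rightarrow>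
   complex ^ ('b + 'f) \<Rightarrow> complex ^ ('b + 'f)" where
  "transition_function E \<pi> V \<phi> \<psi> =
     (\<lambda>p. vpair (\<pi> p) (\<psi> p)) \<circ> inv_into (E \<inter> \<pi> -` V) (\<lambda>p. vpair (\<pi> p) (\<phi> p))"

definition regular_unit_on :: "(complex ^ 'n) set \<Rightarrow> (complex ^ 'n \<Rightarrow> complex) \<Rightarrow> bool" where
  "regular_unit_on X f \<longleftrightarrow> regular_on X f \<and> (\<forall>p\<in>X. f p \<noteq> 0)"

text \<open>
  Triangular automorphisms of the plane over \<open>V\<close>:
  \<open>(\<tau>, \<sigma>) \<mapsto> (a \<tau> + c, d \<sigma> + q(\<tau>))\<close> with \<open>a\<close>, \<open>d\<close> units and \<open>c\<close> an element of the ring \<open>R\<close> of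
  regular functions on \<open>V\<close>, and \<open>q\<close> regular on \<open>V \<times> A\<^sup>1\<close> (that is, \<open>q\<close> in \<open>R[\<tau>]\<close>).
\<close>

definition triangular_automorphism ::
  "(complex ^ 'b) set \<Rightarrow> (complex ^ ('b + 2) \<Rightarrow> complex ^ ('b + 2)) \<Rightarrow> bool" where
  "triangular_automorphism V f \<longleftrightarrow>
     variety_iso (vprod V UNIV) (vprod V UNIV) f \<and>
     (\<exists>a c d q. regular_unit_on V a \<and> regular_on V c \<and> regular_unit_on V d \<and>
        regular_on (vprod V (UNIV :: (complex ^ 1) set)) q \<and>
        (\<forall>b\<in>V. \<forall>\<tau> \<sigma>. f (vpair b (vector [\<tau>, \<sigma>])) =
           vpair b (vector [a b * \<tau> + c b, d b * \<sigma> + q (vpair b (vec \<tau>))])))"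

text \<open>
  Coordinates on affine 4-space are numbered in the order \<open>x, y, z, u\<close>, those on the base in the
  order \<open>v, x\<close>. Rational functions are quotients of polynomial functions; the value \<open>0\<close> that
  they get where the denominator vanishes carries no meaning.
\<close>

definition cx :: "complex ^ 4 \<Rightarrow> complex" where "cx p = p $ 1"
definition cy :: "complex ^ 4 \<Rightarrow> complex" where "cy p = p $ 2"
definition cz :: "complex ^ 4 \<Rightarrow> complex" where "cz p = p $ 3"
definition cu :: "complex ^ 4 \<Rightarrow> complex" where "cu p = p $ 4"

definition ww :: "complex ^ 4 \<Rightarrow> complex" where
  "ww p = (cz p)^2 + cy p * cu p"

definition tt :: "complex ^ 4 \<Rightarrow> complex" where
  "tt p = cx p * cz p + cy p * ww p"

definition ss :: "complex ^ 4 \<Rightarrow> complex" where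
  "ss p = - (2 * cx p * cz p + cy p * ww p) * ww p"

definition eta :: "complex ^ 4 \<Rightarrow> complex" where
  "eta p = ss p + (cx p)^2 * cu p"

definition ven :: "nat \<Rightarrow> complex ^ 4 \<Rightarrow> complex" where
  "ven n p = cy p + (cx p)^n * tt p"

definition zeta :: "nat \<Rightarrow> complex ^ 4 \<Rightarrow> complex" where
  "zeta n p =
     (if n = 1 then
        - ven 1 p * cz p + ven 1 p * tt p * (ven 1 p * cu p + (cz p)^2 + ww p)
          + (tt p)^2 * (cx p * (cz p)^2 + ss p * tt p)
      else if n = 2 then
        - cz p + cx p * tt p * (ven 2 p * cu p + (cz p)^2 + ss p * tt p + ww p)
      else
        - cz p + (cx p)^(n - 3) * tt p * (ven n p * eta p + (cx p)^2 * ww p))"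

definition xi0 :: "complex ^ 4 \<Rightarrow> complex" where
  "xi0 p = eta p / (cx p)^3"

definition xi1 :: "nat \<Rightarrow> complex ^ 4 \<Rightarrow> complex" where
  "xi1 n p = (if n = 1 then zeta 1 p / (ven 1 p)^3 else zeta n p / (ven n p)^2)"

definition Phi :: "nat \<Rightarrow> complex ^ 4 \<Rightarrow> complex ^ 2" where
  "Phi n p = vector [ven n p, cx p]"

definition phi0 :: "complex ^ 4 \<Rightarrow> complex ^ 2" where
  "phi0 p = vector [tt p, xi0 p]"

definition phi1 :: "nat \<Rightarrow> complex ^ 4 \<Rightarrow> complex ^ 2" where
  "phi1 n p = vector [tt p, xi1 n p]"

text \<open>The source and target of \<open>\<lambda>\<^sub>n\<close>, which is the restriction of \<open>\<Phi>\<^sub>n\<close> to the source.\<close>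

definition total_space :: "(complex ^ 4) set" where
  "total_space = UNIV - {p. cx p = 0 \<and> cy p = 0}"

definition punctured_plane :: "(complex ^ 2) set" where
  "punctured_plane = UNIV - {0}"

definition U0 :: "(complex ^ 2) set" where "U0 = {b. b $ 2 \<noteq> 0}"
definition U1 :: "(complex ^ 2) set" where "U1 = {b. b $ 1 \<noteq> 0}"

definition pp :: "nat \<Rightarrow> complex \<Rightarrow> complex \<Rightarrow> complex \<Rightarrow> complex" where
  "pp n x v t =
     (if n = 1 then x^2 * t^4 + x * v * t^3 + v^2 * t^2 - x^2 * v * t
      else if n = 2 then x^2 * t^3 + v * t^2 - x^2 * t
      else v * t^2 - x^2 * t)"

end

theory Submission
  imports Defs
begin

text \<open>
  Everything rests on the identities \<open>x\<^sup>2 w = t\<^sup>2 + y \<eta>\<close> and \<open>x\<^sup>3 \<zeta> = v\<^sup>l \<eta> + p(t)\<close>. Where \<open>x \<noteq> 0\<close>, the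
  first one recovers \<open>w\<close>, \<open>z\<close> and \<open>u\<close> in turn from \<open>v\<close>, \<open>x\<close>, \<open>t\<close> and \<open>\<eta> = x\<^sup>3 \<xi>\<^sub>0\<close>. The second one is the
  transition formula. It also gives \<open>\<eta>\<close> as a polynomial in \<open>x\<close>, \<open>v\<close>, \<open>v\<^sup>-\<^sup>1\<close>, \<open>t\<close>, \<open>\<xi>\<^sub>1\<close>, and the terms of
  \<open>p\<close> are such that the divisions by \<open>x\<close> in the recovery of \<open>w\<close>, \<open>z\<close> and \<open>u\<close> become exact,
  so that the inverse extends to all of \<open>v \<noteq> 0\<close>.
\<close>

section \<open>Regular functions and morphisms\<close>

lemma poly_fun_uminus: "poly_fun f \<Longrightarrow> poly_fun (\<lambda>p. - f p)"
  using poly_fun.mult[OF poly_fun.const[of "-1"]] by simp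

lemma poly_fun_power: "poly_fun f \<Longrightarrow> poly_fun (\<lambda>p. f p ^ k)"
  by (induction k) (auto intro: poly_fun.intros)

lemma poly_fun_diff: "poly_fun f \<Longrightarrow> poly_fun g \<Longrightarrow> poly_fun (\<lambda>p. f p - g p)"
  using poly_fun.add[OF _ poly_fun_uminus] by simp

lemmas poly_fun_intros = poly_fun.intros poly_fun_uminus poly_fun_diff poly_fun_power

lemma zariski_closed_empty: "zariski_closed {}"
  unfolding zariski_closed_def by (rule exI[of _ "{\<lambda>_. 1}"]) (auto intro: poly_fun.const)

lemma zariski_closed_UNIV: "zariski_closed UNIV"
  unfolding zariski_closed_def by (rule exI[of _ "{}"]) auto

lemma zariski_closed_zero: "poly_fun f \<Longrightarrow> zariski_closed {p. f p = 0}"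
  unfolding zariski_closed_def by (rule exI[of _ "{f}"]) auto

lemma zariski_closed_Int:
  assumes "zariski_closed C" "zariski_closed D"
  shows "zariski_closed (C \<inter> D)"
proof -
  obtain S where S: "\<forall>f\<in>S. poly_fun f" "C = {p. \<forall>f\<in>S. f p = 0}"
    using assms(1) unfolding zariski_closed_def by blast
  obtain T where T: "\<forall>f\<in>T. poly_fun f" "D = {p. \<forall>f\<in>T. f p = 0}"
    using assms(2) unfolding zariski_closed_def by blast
  show ?thesis
    unfolding zariski_closed_def using S T by (intro exI[of _ "S \<union> T"]) auto
qed

lemma zariski_closed_Un:
  assumes "zariski_closed C" "zariski_closed D"
  shows "zariski_closed (C \<union> D)"
proof -
  obtain S where S: "\<forall>f\<in>S. poly_fun f" "C = {p. \<forall>f\<in>S. f p = 0}"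
    using assms(1) unfolding zariski_closed_def by blast
  obtain T where T: "\<forall>f\<in>T. poly_fun f" "D = {p. \<forall>f\<in>T. f p = 0}"
    using assms(2) unfolding zariski_closed_def by blast
  show ?thesis
    unfolding zariski_closed_def using S T
    by (intro exI[of _ "(\<lambda>(f, g) p. f p * g p) ` (S \<times> T)"]) (auto intro: poly_fun.mult)
qed

lemma zariski_openin_self: "zariski_openin X X"
  unfolding zariski_openin_def using zariski_closed_empty by blast

lemma zariski_openin_Int:
  "zariski_openin X U \<Longrightarrow> zariski_openin X V \<Longrightarrow> zariski_openin X (U \<inter> V)"
  unfolding zariski_openin_def by (metis Diff_Un zariski_closed_Un)

lemma quasi_affine_Compl: "zariski_closed C \<Longrightarrow> quasi_affine (UNIV - C)"
  unfolding quasi_affine_def zariski_openin_def using zariski_closed_UNIV by blast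

lemma quasi_affine_nonzero:
  assumes "poly_fun f"
  shows "quasi_affine {p. f p \<noteq> 0}"
proof -
  have "UNIV - {p. f p = 0} = {p. f p \<noteq> 0}" by auto
  then show ?thesis using quasi_affine_Compl[OF zariski_closed_zero[OF assms]] by simp
qed

section \<open>The ring of regular functions\<close>

lemma regular_on_cong:
  assumes "regular_on X f" "\<And>p. p \<in> X \<Longrightarrow> f p = g p"
  shows "regular_on X g"
  unfolding regular_on_def
proof
  fix p assume "p \<in> X"
  then obtain U k h where U: "zariski_openin X U" "p \<in> U" "poly_fun k" "poly_fun h"
      "\<forall>q\<in>U. h q \<noteq> 0 \<and> f q = k q / h q"
    using assms(1) unfolding regular_on_def by blast
  have "U \<subseteq> X" using U(1) unfolding zariski_openin_def by auto
  then have "\<forall>q\<in>U. h q \<noteq> 0 \<and> g q = k q / h q" using U(5) assms(2) by (metis subsetD)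
  then show "\<exists>U k h. zariski_openin X U \<and> p \<in> U \<and> poly_fun k \<and> poly_fun h \<and>
      (\<forall>q\<in>U. h q \<noteq> 0 \<and> g q = k q / h q)"
    using U by blast
qed

lemma regular_on_poly_fun: "poly_fun f \<Longrightarrow> regular_on X f"
  unfolding regular_on_def
  by (intro ballI exI[of _ X] exI[of _ f] exI[of _ "\<lambda>_. 1"])
    (auto intro: zariski_openin_self poly_fun.const)

text \<open>Sums, products and quotients share one argument: near a point both functions are
  fractions of polynomial functions, and on the intersection of the two neighbourhoods the result is
  the fraction \<open>R / S\<close>. The condition on values is pointwise, with \<open>q\<close> in
  \<open>X\<close>, so that a quotient may use that its divisor has no zero on
  \<open>X\<close>.\<close>

lemma regular_on_binop:
  fixes X :: "(complex ^ 'n) set"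
  assumes "regular_on X f" "regular_on X g"
    and poly: "\<And>a b c d :: complex ^ 'n \<Rightarrow> complex. poly_fun a \<Longrightarrow> poly_fun b \<Longrightarrow> poly_fun c \<Longrightarrow> poly_fun d \<Longrightarrow>
      poly_fun (\<lambda>q. R (a q) (b q) (c q) (d q)) \<and> poly_fun (\<lambda>q. S (a q) (b q) (c q) (d q))"
    and eq: "\<And>q a b c d. q \<in> X \<Longrightarrow> b \<noteq> 0 \<Longrightarrow> d \<noteq> 0 \<Longrightarrow> f q = a / b \<Longrightarrow> g q = c / d \<Longrightarrow>
      S a b c d \<noteq> 0 \<and> h q = R a b c d / S a b c d"
  shows "regular_on X h"
  unfolding regular_on_def
proof
  fix p assume "p \<in> X"
  obtain U a b where U: "zariski_openin X U" "p \<in> U" "poly_fun a" "poly_fun b"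
      "\<forall>q\<in>U. b q \<noteq> 0 \<and> f q = a q / b q"
    using assms(1) \<open>p \<in> X\<close> unfolding regular_on_def by blast
  obtain V c d where V: "zariski_openin X V" "p \<in> V" "poly_fun c" "poly_fun d"
      "\<forall>q\<in>V. d q \<noteq> 0 \<and> g q = c q / d q"
    using assms(2) \<open>p \<in> X\<close> unfolding regular_on_def by blast
  have "U \<subseteq> X" using U(1) unfolding zariski_openin_def by auto
  then have "S (a q) (b q) (c q) (d q) \<noteq> 0 \<and>
      h q = R (a q) (b q) (c q) (d q) / S (a q) (b q) (c q) (d q)" if "q \<in> U \<inter> V" for q
    using that U(5) V(5) by (intro eq) auto
  then show "\<exists>W r s. zariski_openin X W \<and> p \<in> W \<and> poly_fun r \<and> poly_fun s \<and>
      (\<forall>q\<in>W. s q \<noteq> 0 \<and> h q = r q / s q)"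
    using poly[OF U(3,4) V(3,4)] zariski_openin_Int[OF U(1) V(1)] U(2) V(2)
    by - (rule exI[of _ "U \<inter> V"], rule exI[of _ "\<lambda>q. R (a q) (b q) (c q) (d q)"],
        rule exI[of _ "\<lambda>q. S (a q) (b q) (c q) (d q)"], simp)
qed

lemma regular_on_add:
  assumes "regular_on X f" "regular_on X g"
  shows "regular_on X (\<lambda>p. f p + g p)"
  by (rule regular_on_binop[OF assms, of "\<lambda>a b c d. a * d + c * b" "\<lambda>a b c d. b * d"])
    (auto intro!: poly_fun_intros simp: add_frac_eq)

lemma regular_on_mult:
  assumes "regular_on X f" "regular_on X g"
  shows "regular_on X (\<lambda>p. f p * g p)"
  by (rule regular_on_binop[OF assms, of "\<lambda>a b c d. a * c" "\<lambda>a b c d. b * d"])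
    (auto intro!: poly_fun_intros)

lemma regular_on_divide:
  assumes "regular_on X f" "regular_on X g" and nz: "\<And>p. p \<in> X \<Longrightarrow> g p \<noteq> 0"
  shows "regular_on X (\<lambda>p. f p / g p)"
proof (rule regular_on_binop[OF assms(1,2), of "\<lambda>a b c d. a * d" "\<lambda>a b c d. b * c"])
  fix q a b c d assume "q \<in> X" "b \<noteq> 0" "d \<noteq> 0" "f q = a / b" "g q = c / d"
  then show "b * c \<noteq> 0 \<and> f q / g q = a * d / (b * c)" using nz[of q] by auto
qed (auto intro: poly_fun_intros)

lemma regular_on_uminus: "regular_on X f \<Longrightarrow> regular_on X (\<lambda>p. - f p)"
  using regular_on_mult[OF regular_on_poly_fun[OF poly_fun.const[of "-1"]]] by simp

lemma regular_on_diff: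
  "regular_on X f \<Longrightarrow> regular_on X g \<Longrightarrow> regular_on X (\<lambda>p. f p - g p)"
  using regular_on_add[OF _ regular_on_uminus] by simp

lemma regular_on_const: "regular_on X (\<lambda>_. c)"
  by (rule regular_on_poly_fun[OF poly_fun.const])

lemma regular_on_power: "regular_on X f \<Longrightarrow> regular_on X (\<lambda>p. f p ^ k)"
  by (induction k) (simp_all add: regular_on_const regular_on_mult)

lemma regular_on_coord: "regular_on X (\<lambda>p. p $ i)"
  by (rule regular_on_poly_fun[OF poly_fun.coord])

lemmas regular_on_intros = regular_on_const regular_on_coord regular_on_add regular_on_mult
  regular_on_uminus regular_on_diff regular_on_power regular_on_divide

section \<open>Pairs, products with affine space, and coordinate vectors\<close>

lemma vpair_nth [simp]: "vpair a b $ Inl i = a $ i" "vpair a b $ Inr j = b $ j"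
  by (simp_all add: vpair_def)

lemma vpair_eq_iff [simp]: "vpair a b = vpair c d \<longleftrightarrow> a = c \<and> b = d"
  by (metis vec_eq_iff vpair_nth)

lemma vpair_eta: "vpair (\<chi> i. q $ Inl i) (\<chi> j. q $ Inr j) = q"
  by (simp add: vpair_def vec_eq_iff split: sum.split)

lemma vpair_in_vprod_UNIV [simp]: "vpair a b \<in> vprod X UNIV \<longleftrightarrow> a \<in> X"
  unfolding vprod_def by auto

text \<open>The product becomes the preimage under the base projection. Over a principal open set it
  is thus again a principal open set, hence quasi-affine.\<close>

lemma vprod_UNIV: "vprod X UNIV = {q. (\<chi> i. q $ Inl i) \<in> X}"
proof (rule set_eqI)
  fix q :: "complex ^ ('a + 'b)"
  have "q \<in> vprod X UNIV \<longleftrightarrow> vpair (\<chi> i. q $ Inl i) (\<chi> j. q $ Inr j) \<in> vprod X UNIV"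
    by (simp only: vpair_eta)
  then show "q \<in> vprod X UNIV \<longleftrightarrow> q \<in> {q. (\<chi> i. q $ Inl i) \<in> X}" by simp
qed

lemma regular_on_vpair:
  assumes "\<And>i. regular_on X (\<lambda>p. f p $ i)" "\<And>j. regular_on X (\<lambda>p. g p $ j)"
  shows "regular_on X (\<lambda>p. vpair (f p) (g p) $ k)"
  using assms by (cases k) auto

lemma regular_on_vector_2:
  assumes "regular_on X f" "regular_on X g"
  shows "regular_on X (\<lambda>p. (vector [f p, g p] :: complex ^ 2) $ i)"
  using assms exhaust_2[of i] by auto

lemma vector_4 [simp]:
  "(vector [a, b, c, d] :: 'a::zero ^ 4) $ 1 = a" "(vector [a, b, c, d] :: 'a ^ 4) $ 2 = b"
  "(vector [a, b, c, d] :: 'a ^ 4) $ 3 = c" "(vector [a, b, c, d] :: 'a ^ 4) $ 4 = d"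
  unfolding vector_def by simp_all

lemma regular_on_vector_4:
  assumes "regular_on X f" "regular_on X g" "regular_on X h" "regular_on X k"
  shows "regular_on X (\<lambda>p. (vector [f p, g p, h p, k p] :: complex ^ 4) $ i)"
  using assms exhaust_4[of i] by auto

lemma vector_2_eta: "vector [b $ 1, b $ 2] = (b :: 'a::zero ^ 2)"
  by (simp add: vec_eq_iff forall_2)

lemma vector_2_eq_iff: "vector [a, b] = (vector [c, d] :: 'a::zero ^ 2) \<longleftrightarrow> a = c \<and> b = d"
  by (metis vector_2)

section \<open>Isomorphisms and transition functions\<close>

lemma variety_isoI:
  assumes "variety_morphism X Y f" "variety_morphism Y X g"
    and "\<And>p. p \<in> X \<Longrightarrow> g (f p) = p" "\<And>q. q \<in> Y \<Longrightarrow> f (g q) = q"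
  shows "variety_iso X Y f"
  unfolding variety_iso_def using assms by (intro conjI exI[of _ g]) auto

text \<open>The isomorphism provides a left inverse of the chart and hence injectivity, so the
  \<open>inv_into\<close> in the definition returns the point \<open>p\<close> itself.\<close>

lemma transition_function_vpair:
  assumes "variety_iso (E \<inter> \<pi> -` V) Y (\<lambda>p. vpair (\<pi> p) (\<phi> p))" "p \<in> E" "\<pi> p \<in> V"
  shows "transition_function E \<pi> V \<phi> \<psi> (vpair (\<pi> p) (\<phi> p)) = vpair (\<pi> p) (\<psi> p)"
proof -
  obtain g where "\<forall>p \<in> E \<inter> \<pi> -` V. g (vpair (\<pi> p) (\<phi> p)) = p"
    using assms(1) unfolding variety_iso_def by blast
  then have "inj_on (\<lambda>p. vpair (\<pi> p) (\<phi> p)) (E \<inter> \<pi> -` V)"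
    by (intro inj_on_inverseI[of _ g]) blast
  then have "inv_into (E \<inter> \<pi> -` V) (\<lambda>p. vpair (\<pi> p) (\<phi> p)) (vpair (\<pi> p) (\<phi> p)) = p"
    using assms(2,3) by (intro inv_into_f_eq) auto
  then show ?thesis by (simp add: transition_function_def)
qed

text \<open>A transition function is built from \<open>inv_into\<close>, so its values are
  controlled only on the product over \<open>V\<close>. This lemma lets an explicit map with the
  same values there stand in for it.\<close>

lemma variety_iso_cong:
  assumes "variety_iso X Y f" "\<And>p. p \<in> X \<Longrightarrow> f p = g p"
  shows "variety_iso X Y g"
proof -
  obtain h where f: "variety_morphism X Y f" and h: "variety_morphism Y X h"
      "\<forall>p\<in>X. h (f p) = p" "\<forall>q\<in>Y. f (h q) = q"
    using assms(1) unfolding variety_iso_def by blast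
  have "variety_morphism X Y g"
    using f assms(2) regular_on_cong[of X "\<lambda>p. f p $ i" "\<lambda>p. g p $ i" for i]
    by (auto simp: variety_morphism_def image_subset_iff)
  moreover have "h q \<in> X" if "q \<in> Y" for q
    using h(1) that by (auto simp: variety_morphism_def)
  ultimately show ?thesis using h assms(2) by (intro variety_isoI[of X Y g h]) auto
qed

section \<open>Shears of the plane over a base\<close>

definition shear ::
    "(complex ^ 'b \<Rightarrow> complex \<Rightarrow> complex) \<Rightarrow> complex ^ ('b + 2) \<Rightarrow> complex ^ ('b + 2)" where
  "shear h q = (let b = \<chi> i. q $ Inl i in vpair b (vector [q $ Inr 1, q $ Inr 2 + h b (q $ Inr 1)]))"

lemma shear_vpair [simp]:
  "shear h (vpair b (vector [\<tau>, \<sigma>])) = vpair b (vector [\<tau>, \<sigma> + h b \<tau>])"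
  by (simp add: shear_def Let_def)

lemma vprod_UNIV_cases:
  fixes q :: "complex ^ ('b::finite + 2)"
  assumes "q \<in> vprod V UNIV"
  obtains b \<tau> \<sigma> where "b \<in> V" "q = vpair b (vector [\<tau>, \<sigma>])"
  using assms unfolding vprod_def by (auto, metis vector_2_eta)

lemma variety_morphism_shear:
  fixes V :: "(complex ^ 'b) set"
  assumes "quasi_affine (vprod V (UNIV :: (complex ^ 2) set))"
    and "regular_on (vprod V (UNIV :: (complex ^ 2) set)) (\<lambda>q. h (\<chi> i. q $ Inl i) (q $ Inr 1))"
  shows "variety_morphism (vprod V (UNIV :: (complex ^ 2) set)) (vprod V UNIV) (shear h)"
proof -
  have "regular_on (vprod V (UNIV :: (complex ^ 2) set)) (\<lambda>q. shear h q $ i)" for i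
    unfolding shear_def Let_def
    by (intro regular_on_vpair regular_on_vector_2 regular_on_add regular_on_coord assms(2))
      (simp add: regular_on_coord)
  then show ?thesis
    using assms(1) by (auto simp: variety_morphism_def elim!: vprod_UNIV_cases)
qed

text \<open>The inverse of a shear is the shear by \<open>- h\<close>, and the triangular form is
  met with both units equal to 1 and the translation equal to 0. Regularity of \<open>h\<close>
  enters twice because the isomorphism lives on \<open>V\<close> times the plane, whereas
  \<open>q\<close> in the triangular form lives on \<open>V\<close> times the line.\<close>

lemma triangular_automorphism_shear:
  fixes V :: "(complex ^ 'b) set"
  assumes "quasi_affine (vprod V (UNIV :: (complex ^ 2) set))"
    and "regular_on (vprod V (UNIV :: (complex ^ 2) set)) (\<lambda>q. h (\<chi> i. q $ Inl i) (q $ Inr 1))"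
    and "regular_on (vprod V (UNIV :: (complex ^ 1) set)) (\<lambda>q. h (\<chi> i. q $ Inl i) (q $ Inr 1))"
    and f: "\<And>b \<tau> \<sigma>. b \<in> V \<Longrightarrow> f (vpair b (vector [\<tau>, \<sigma>])) = vpair b (vector [\<tau>, \<sigma> + h b \<tau>])"
  shows "triangular_automorphism V f"
proof -
  have "variety_iso (vprod V (UNIV :: (complex ^ 2) set)) (vprod V UNIV) (shear h)"
    by (rule variety_isoI[of _ _ _ "shear (\<lambda>b \<tau>. - h b \<tau>)"])
      (auto intro!: variety_morphism_shear assms regular_on_uminus elim!: vprod_UNIV_cases)
  then have "variety_iso (vprod V (UNIV :: (complex ^ 2) set)) (vprod V UNIV) f"
    by (rule variety_iso_cong) (auto simp: f elim!: vprod_UNIV_cases)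
  moreover have "f (vpair b (vector [\<tau>, \<sigma>])) = vpair b (vector [1 * \<tau> + 0, 1 * \<sigma> +
      h (\<chi> i. vpair b (vec \<tau> :: complex ^ 1) $ Inl i) (vpair b (vec \<tau> :: complex ^ 1) $ Inr 1)])"
    if "b \<in> V" for b \<tau> \<sigma>
    using f[OF that] by simp
  ultimately show ?thesis
    unfolding triangular_automorphism_def regular_unit_on_def using assms(3)
    by (intro conjI exI[of _ "\<lambda>_. 1"] exI[of _ "\<lambda>_. 0"]
        exI[of _ "\<lambda>q. h (\<chi> i. q $ Inl i) (q $ Inr 1)"]) (auto intro: regular_on_const)
qed

section \<open>Algebra of the Venereau polynomials\<close>

lemma power_split: "k \<le> n \<Longrightarrow> x ^ n = x ^ (n - k) * x ^ k" for x :: "'a::monoid_mult"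
  by (simp flip: power_add)

text \<open>Since \<open>s = - (t + x z) w\<close>, substituting \<open>y u = w - z^2\<close> and
  \<open>y w = t - x z\<close> into \<open>y eta\<close> gives
  \<open>x^2 (w - z^2) - (t + x z) (t - x z)\<close>, where the terms in \<open>z\<close>
  cancel.\<close>

lemma ww_relation: "(cx p)\<^sup>2 * ww p = (tt p)\<^sup>2 + cy p * eta p"
  unfolding eta_def ss_def tt_def ww_def by algebra

lemma eta_eq: "eta p = (cx p)\<^sup>2 * cu p - (tt p + cx p * cz p) * ww p"
  unfolding eta_def ss_def tt_def by algebra

text \<open>The variable \<open>u\<close> is eliminated through
  \<open>v u = w - z^2 + x t u\<close>; the remaining terms in \<open>u\<close> and \<open>s\<close>
  combine to a multiple of \<open>x^2 u + s = eta\<close>. The same happens in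
  \<open>zeta_2\<close>, with \<open>x^2 t u\<close> in place of \<open>x t u\<close>.\<close>

lemma zeta_1: "zeta 1 p =
    - ven 1 p * cz p + tt p * (2 * ven 1 p * ww p + cx p * tt p * ww p + (tt p)\<^sup>2 * eta p)"
proof -
  have "cy p * cu p = ww p - (cz p)\<^sup>2" by (simp add: ww_def)
  moreover have "ven 1 p = cy p + cx p * tt p" by (simp add: ven_def)
  moreover have "eta p = ss p + (cx p)\<^sup>2 * cu p" by (rule eta_def)
  ultimately show ?thesis unfolding zeta_def by simp algebra
qed

lemma zeta_2: "zeta 2 p = - cz p + cx p * tt p * (2 * ww p + tt p * eta p)"
proof -
  have "cy p * cu p = ww p - (cz p)\<^sup>2" by (simp add: ww_def)
  moreover have "ven 2 p = cy p + (cx p)\<^sup>2 * tt p" by (simp add: ven_def)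
  moreover have "eta p = ss p + (cx p)\<^sup>2 * cu p" by (rule eta_def)
  ultimately show ?thesis unfolding zeta_def by simp algebra
qed

lemma zeta_ge_3: "n \<ge> 3 \<Longrightarrow>
    zeta n p = - cz p + (cx p) ^ (n - 3) * tt p * (ven n p * eta p + (cx p)\<^sup>2 * ww p)"
  by (simp add: zeta_def)

definition lexp :: "nat \<Rightarrow> nat" where "lexp n = (if n = 1 then 3 else 2)"

text \<open>For \<open>n \<ge> 3\<close> the factor \<open>x^3\<close> turns
  \<open>x^(n-3) t\<close> into \<open>x^n t = v - y\<close>. Then
  \<open>(v - y) (v eta + x^2 w) - x^3 z\<close> regroups as
  \<open>v^2 eta + v (x^2 w - y eta) - x^2 (x z + y w)\<close>, which is
  \<open>v^2 eta + v t^2 - x^2 t\<close>. The small cases use the same two relations.\<close>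

lemma zeta_transition:
  assumes "n \<ge> 1"
  shows "(cx p) ^ 3 * zeta n p = ven n p ^ lexp n * eta p + pp n (cx p) (ven n p) (tt p)"
proof -
  have w: "(cx p)\<^sup>2 * ww p = (tt p)\<^sup>2 + cy p * eta p" by (rule ww_relation)
  have t: "cx p * cz p + cy p * ww p = tt p" by (simp add: tt_def)
  consider "n = 1" | "n = 2" | "n \<ge> 3" using assms by linarith
  then show ?thesis
  proof cases
    case 1
    have v: "ven 1 p = cy p + cx p * tt p" by (simp add: ven_def)
    show ?thesis unfolding 1 zeta_1 pp_def lexp_def using v t w by simp algebra
  next
    case 2
    have v: "ven 2 p = cy p + (cx p)\<^sup>2 * tt p" by (simp add: ven_def)
    show ?thesis unfolding 2 zeta_2 pp_def lexp_def using v t w by simp algebra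
  next
    case 3
    \<comment> \<open>Naming this power leaves a polynomial identity with fixed exponents, which
      \<open>algebra\<close> can treat.\<close>
    define m where "m = (cx p) ^ (n - 3)"
    have "ven n p = cy p + m * (cx p) ^ 3 * tt p"
      using 3 by (simp add: ven_def m_def flip: power_add)
    moreover have "zeta n p = - cz p + m * tt p * (ven n p * eta p + (cx p)\<^sup>2 * ww p)"
      unfolding m_def by (rule zeta_ge_3[OF 3])
    ultimately have "(cx p) ^ 3 * zeta n p =
        (ven n p)\<^sup>2 * eta p + (ven n p * (tt p)\<^sup>2 - (cx p)\<^sup>2 * tt p)"
      using t w by algebra
    then show ?thesis using 3 by (simp add: pp_def lexp_def)
  qed
qed

text \<open>This is \<open>x^3 zeta = v^l eta + p\<close> solved for \<open>eta\<close> after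
  putting \<open>zeta = v^l \<xi>\<close>; only \<open>v\<close> is inverted.\<close>

definition eta_of :: "nat \<Rightarrow> complex \<Rightarrow> complex \<Rightarrow> complex \<Rightarrow> complex \<Rightarrow> complex" where
  "eta_of n v x t \<xi> = x ^ 3 * \<xi> - pp n x v t / v ^ lexp n"

text \<open>
  The inverse of the chart over \<open>v \<noteq> 0\<close>. The obvious formulas divide by \<open>x\<close>; these come from
  clearing \<open>x\<close> with \<open>x\<^sup>3 \<zeta> = v\<^sup>l \<eta> + p\<close>, \<open>t = x z + y w\<close> and \<open>v = y + x\<^sup>n t\<close>. For \<open>w\<close> the case
  \<open>n \<ge> 3\<close> is \<open>v w = x \<zeta> + t - x\<^sup>n\<^sup>-\<^sup>2 t v \<eta>\<close>; when \<open>n = 1\<close>, one multiplies by \<open>v - x t\<close> first.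
\<close>

definition w_of :: "nat \<Rightarrow> complex \<Rightarrow> complex \<Rightarrow> complex \<Rightarrow> complex \<Rightarrow> complex" where
  "w_of n v x t \<xi> =
     (if n = 1 then ((v - x * t) * (t * v + x * v ^ 3 * \<xi>) + x * t ^ 5) / v ^ 3
      else v * x * \<xi> + (t - (if n = 2 then t ^ 3 else 0)) / v - x ^ (n - 2) * t * eta_of n v x t \<xi>)"

text \<open>Each branch is the matching formula among \<open>zeta_1\<close>, \<open>zeta_2\<close>,
  \<open>zeta_ge_3\<close>, solved for \<open>z\<close> after putting
  \<open>zeta = v^l \<xi>\<close>. For \<open>n = 1\<close> the coefficient of \<open>z\<close> is
  \<open>- v\<close> instead of -1; hence the division by \<open>v\<close>, and the same first
  summand in all cases although \<open>l = 3\<close>.\<close>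

definition z_of :: "nat \<Rightarrow> complex \<Rightarrow> complex \<Rightarrow> complex \<Rightarrow> complex \<Rightarrow> complex" where
  "z_of n v x t \<xi> = (let e = eta_of n v x t \<xi>; w = w_of n v x t \<xi> in
     - v\<^sup>2 * \<xi> +
     (if n = 1 then t * (2 * v * w + x * t * w + t\<^sup>2 * e) / v
      else if n = 2 then x * t * (2 * w + t * e)
      else x ^ (n - 3) * t * (v * e + x\<^sup>2 * w)))"

text \<open>Here \<open>w - z^2\<close> stands for \<open>y u\<close> and \<open>r\<close> for
  \<open>x^2 u\<close>. For \<open>n \<ge> 2\<close>, \<open>v = y + (x^(n-2) t) x^2\<close> makes
  \<open>v u\<close> a combination of the two. For \<open>n = 1\<close> the term \<open>x t\<close>
  has too few factors \<open>x\<close>; instead \<open>v^2 = (v + x t) y + t^2 x^2\<close> is used,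
  hence the division by \<open>v^2\<close>.\<close>

definition u_of :: "nat \<Rightarrow> complex \<Rightarrow> complex \<Rightarrow> complex \<Rightarrow> complex \<Rightarrow> complex" where
  "u_of n v x t \<xi> = (let w = w_of n v x t \<xi>; z = z_of n v x t \<xi>;
       r = eta_of n v x t \<xi> + (t + x * z) * w in
     if n = 1 then ((v + x * t) * (w - z\<^sup>2) + t\<^sup>2 * r) / v\<^sup>2
     else (w - z\<^sup>2 + x ^ (n - 2) * t * r) / v)"

lemma eta_of_mult:
  "v \<noteq> 0 \<Longrightarrow> v ^ lexp n * eta_of n v x t \<xi> = v ^ lexp n * x ^ 3 * \<xi> - pp n x v t"
  by (simp add: eta_of_def right_diff_distrib)

section \<open>Relations satisfied by the inverse formulas, including at
  \<open>x = 0\<close>\<close>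

context
  fixes n :: nat and v x t \<xi> y e w z u :: complex
  assumes n: "n \<ge> 1" and v: "v \<noteq> 0"
  defines "y \<equiv> v - x ^ n * t" and "e \<equiv> eta_of n v x t \<xi>" and "w \<equiv> w_of n v x t \<xi>"
    and "z \<equiv> z_of n v x t \<xi>" and "u \<equiv> u_of n v x t \<xi>"
begin

text \<open>All formulas are polynomial in \<open>x\<close>, \<open>t\<close>, \<open>\<xi>\<close>,
  \<open>v\<close> and the inverse of \<open>v\<close>. The facts \<open>E\<close>, \<open>W\<close>
  and \<open>Z\<close> clear the denominators; both relations then become polynomial identities, and
  a power of \<open>v\<close> is cancelled. As \<open>x\<close> is never cancelled, the argument
  covers \<open>x = 0\<close>.\<close>

lemma z_w_of_relations: "x * z + y * w = t" "x\<^sup>2 * w = t\<^sup>2 + y * e"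
proof -
  have "x * z + y * w = t \<and> x\<^sup>2 * w = t\<^sup>2 + y * e"
  proof -
    consider "n = 1" | "n = 2" | "n \<ge> 3" using n by linarith
    then show ?thesis
    proof cases
      case 1
      have y: "y = v - x * t" using 1 by (simp add: y_def)
      have E: "v ^ 3 * e = v ^ 3 * x ^ 3 * \<xi> - (x\<^sup>2 * t ^ 4 + x * v * t ^ 3 + v\<^sup>2 * t\<^sup>2 - x\<^sup>2 * v * t)"
        using eta_of_mult[OF v, of n x t \<xi>] 1 by (simp add: e_def pp_def lexp_def)
      have W: "v ^ 3 * w = (v - x * t) * (t * v + x * v ^ 3 * \<xi>) + x * t ^ 5"
        using 1 v by (simp add: w_def w_of_def)
      have "v * z = - (v ^ 3 * \<xi>) + t * (2 * v * w + x * t * w + t\<^sup>2 * e)"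
        using 1 v by (simp add: z_def z_of_def Let_def w_def e_def field_simps
            power3_eq_cube power2_eq_square)
      \<comment> \<open>The further factor \<open>v ^ 3\<close> produces the left sides of
        \<open>W\<close> and \<open>E\<close>, so that \<open>w\<close> and \<open>e\<close> can be
        replaced by their cleared forms.\<close>
      then have Z: "v ^ 3 * (v * z) = - (v ^ 6 * \<xi>) + t * ((2 * v + x * t) * (v ^ 3 * w) + t\<^sup>2 * (v ^ 3 * e))"
        by algebra
      have "x\<^sup>2 * (v ^ 3 * w) = v ^ 3 * t\<^sup>2 + y * (v ^ 3 * e)"
        unfolding E W y by algebra
      then have "v ^ 3 * (x\<^sup>2 * w) = v ^ 3 * (t\<^sup>2 + y * e)" by algebra
      moreover have "x * (v ^ 3 * (v * z)) + y * v * (v ^ 3 * w) = v ^ 4 * t"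
        unfolding Z E W y by algebra
      then have "v ^ 4 * (x * z + y * w) = v ^ 4 * t" by algebra
      ultimately show ?thesis using v by simp
    next
      case 2
      have y: "y = v - x\<^sup>2 * t" using 2 by (simp add: y_def)
      have E: "v\<^sup>2 * e = v\<^sup>2 * x ^ 3 * \<xi> - (x\<^sup>2 * t ^ 3 + v * t\<^sup>2 - x\<^sup>2 * t)"
        using eta_of_mult[OF v, of n x t \<xi>] 2 by (simp add: e_def pp_def lexp_def)
      have "v * w = v\<^sup>2 * x * \<xi> + (t - t ^ 3) - v * t * e"
        using 2 v by (simp add: w_def w_of_def e_def field_simps power2_eq_square)
      then have W: "v\<^sup>2 * w = v ^ 3 * x * \<xi> + v * (t - t ^ 3) - t * (v\<^sup>2 * e)" by algebra
      have "z = - v\<^sup>2 * \<xi> + x * t * (2 * w + t * e)"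
        using 2 by (simp add: z_def z_of_def Let_def w_def e_def)
      then have Z: "v\<^sup>2 * z = - (v ^ 4 * \<xi>) + x * t * (2 * (v\<^sup>2 * w) + t * (v\<^sup>2 * e))" by algebra
      have "x\<^sup>2 * (v\<^sup>2 * w) = v\<^sup>2 * t\<^sup>2 + y * (v\<^sup>2 * e)"
        unfolding W E y by algebra
      then have "v\<^sup>2 * (x\<^sup>2 * w) = v\<^sup>2 * (t\<^sup>2 + y * e)" by algebra
      moreover have "x * (v\<^sup>2 * z) + y * (v\<^sup>2 * w) = v\<^sup>2 * t"
        unfolding Z W E y by algebra
      then have "v\<^sup>2 * (x * z + y * w) = v\<^sup>2 * t" by algebra
      ultimately show ?thesis using v by simp
    next
      case 3
      define m where "m = x ^ (n - 3)"
      have "n - 2 = Suc (n - 3)" using 3 by simp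
      then have m: "x ^ n = m * x ^ 3" "x ^ (n - 2) = m * x"
        using power_split[OF 3] by (simp_all add: m_def)
      have y: "y = v - m * x ^ 3 * t" by (simp add: y_def m)
      have E: "v\<^sup>2 * e = v\<^sup>2 * x ^ 3 * \<xi> - (v * t\<^sup>2 - x\<^sup>2 * t)"
        using eta_of_mult[OF v, of n x t \<xi>] 3 by (simp add: e_def pp_def lexp_def)
      have "v * w = v\<^sup>2 * x * \<xi> + t - v * (m * x * t * e)"
        using 3 v by (simp add: w_def w_of_def e_def m right_diff_distrib
            distrib_left power2_eq_square)
      then have W: "v\<^sup>2 * w = v ^ 3 * x * \<xi> + v * t - m * x * t * (v\<^sup>2 * e)" by algebra
      have "z = - v\<^sup>2 * \<xi> + m * t * (v * e + x\<^sup>2 * w)"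
        using 3 by (simp add: z_def z_of_def Let_def w_def e_def m_def)
      then have Z: "v\<^sup>2 * z = - (v ^ 4 * \<xi>) + m * t * (v * (v\<^sup>2 * e) + x\<^sup>2 * (v\<^sup>2 * w))" by algebra
      have "x\<^sup>2 * (v\<^sup>2 * w) = v\<^sup>2 * t\<^sup>2 + y * (v\<^sup>2 * e)"
        unfolding W E y by algebra
      then have "v\<^sup>2 * (x\<^sup>2 * w) = v\<^sup>2 * (t\<^sup>2 + y * e)" by algebra
      moreover have "x * (v\<^sup>2 * z) + y * (v\<^sup>2 * w) = v\<^sup>2 * t"
        unfolding Z W E y by algebra
      then have "v\<^sup>2 * (x * z + y * w) = v\<^sup>2 * t" by algebra
      ultimately show ?thesis using v by simp
    qed
  qed
  then show "x * z + y * w = t" "x\<^sup>2 * w = t\<^sup>2 + y * e" by auto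
qed

text \<open>Two equations prescribe \<open>u\<close>, one through \<open>y u\<close> and one through
  \<open>x^2 u\<close>; \<open>y r = x^2 (w - z^2)\<close> is their compatibility. Because
  \<open>v\<close>, or \<open>v^2\<close> when \<open>n = 1\<close>, is a combination of
  \<open>y\<close> and \<open>x^2\<close>, the formula for \<open>u\<close> satisfies both equations
  once the unit is cancelled.\<close>

lemma u_of_relations: "z\<^sup>2 + y * u = w" "x\<^sup>2 * u = e + (t + x * z) * w"
proof -
  define r where "r = e + (t + x * z) * w"
  have r: "y * r = x\<^sup>2 * (w - z\<^sup>2)" proof -
    have "y * r = y * e + (t + x * z) * (y * w)" by (simp add: r_def algebra_simps)
    moreover have "y * e = x\<^sup>2 * w - t\<^sup>2" "y * w = t - x * z"
      using z_w_of_relations by (auto simp: algebra_simps)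
    ultimately show ?thesis using z_w_of_relations by algebra
  qed
  have "v * (y * u) = v * (w - z\<^sup>2) \<and> v * (x\<^sup>2 * u) = v * r"
  proof (cases "n = 1")
    case True
    have "v\<^sup>2 * u = (v + x * t) * (w - z\<^sup>2) + t\<^sup>2 * r"
      using True v unfolding u_def u_of_def Let_def r_def w_def z_def e_def by simp
    moreover have "y = v - x * t" by (simp add: y_def True)
    ultimately have "v * (v * (y * u)) = v * (v * (w - z\<^sup>2))" "v * (v * (x\<^sup>2 * u)) = v * (v * r)"
      using r by algebra+
    then show ?thesis using v by simp
  next
    case False
    define m where "m = x ^ (n - 2)"
    have m: "x ^ n = m * x\<^sup>2" unfolding m_def using n False by (intro power_split) simp
    have "v * u = w - z\<^sup>2 + m * t * r"
      using False v unfolding u_def u_of_def Let_def r_def w_def z_def e_def m_def by simp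
    moreover have "y = v - m * x\<^sup>2 * t" by (simp add: y_def m)
    ultimately show ?thesis using r by algebra
  qed
  then show "z\<^sup>2 + y * u = w" "x\<^sup>2 * u = e + (t + x * z) * w" using v r_def by auto
qed

end

lemma zeta_xi1: "ven n p \<noteq> 0 \<Longrightarrow> zeta n p = ven n p ^ lexp n * xi1 n p"
  by (cases "n = 1") (simp_all add: xi1_def lexp_def)

section \<open>Recovering a point from its coordinates in the chart over
  \<open>v \<noteq> 0\<close>\<close>

context
  fixes n :: nat and p :: "complex ^ 4"
  assumes n: "n \<ge> 1" and v: "ven n p \<noteq> 0"
begin

lemma eta_of_xi1: "eta_of n (ven n p) (cx p) (tt p) (xi1 n p) = eta p"
proof -
  have "(cx p) ^ 3 * (ven n p ^ lexp n * xi1 n p) = ven n p ^ lexp n * eta p + pp n (cx p) (ven n p) (tt p)"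
    using zeta_transition[OF n] zeta_xi1[OF v] by metis
  then show ?thesis using v by (simp add: eta_of_def field_simps)
qed

text \<open>For \<open>n \<ge> 3\<close>, \<open>x zeta + t - x^(n-2) t v eta\<close> equals
  \<open>(t - x z) + x^n t w\<close>, and \<open>t - x z = y w\<close> makes this
  \<open>v w\<close>. For \<open>n = 2\<close> the additional \<open>- t^3\<close> is absorbed by
  \<open>x^2 w = t^2 + y eta\<close>.\<close>

lemma w_of_xi1: "w_of n (ven n p) (cx p) (tt p) (xi1 n p) = ww p"
proof -
  have w: "(cx p)\<^sup>2 * ww p = (tt p)\<^sup>2 + cy p * eta p" by (rule ww_relation)
  have t: "cx p * cz p + cy p * ww p = tt p" by (simp add: tt_def)
  have z: "zeta n p = ven n p ^ lexp n * xi1 n p" by (rule zeta_xi1[OF v])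
  consider "n = 1" | "n = 2" | "n \<ge> 3" using n by linarith
  then show ?thesis
  proof cases
    case 1
    have y: "ven 1 p = cy p + cx p * tt p" by (simp add: ven_def)
    \<comment> \<open>With \<open>y = v - x t\<close>, the product on the left is
      \<open>(v^3 - x^3 t^3) w + x t^3 y eta\<close>. The term \<open>x t^5\<close> completes the
      second summand to \<open>x t^3 (t^2 + y eta) = x^3 t^3 w\<close>.\<close>
    have "(ven 1 p - cx p * tt p) * (tt p * ven 1 p + cx p * zeta 1 p) + cx p * tt p ^ 5 = ven 1 p ^ 3 * ww p"
      unfolding zeta_1 using y t w by algebra
    then show ?thesis using v z 1 by (simp add: w_of_def lexp_def mult.assoc)
  next
    case 2
    have y: "ven 2 p = cy p + (cx p)\<^sup>2 * tt p" by (simp add: ven_def)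
    have "cx p * zeta 2 p + tt p - tt p ^ 3 - ven 2 p * tt p * eta p = ven 2 p * ww p"
      unfolding zeta_2 using y t w by algebra
    then have "ven 2 p * w_of n (ven 2 p) (cx p) (tt p) (xi1 n p) = ven 2 p * ww p"
      using v z 2 eta_of_xi1 by (simp add: w_of_def lexp_def field_simps power2_eq_square)
    then show ?thesis using v 2 by simp
  next
    case 3
    define m where "m = (cx p) ^ (n - 3)"
    have "n - 2 = Suc (n - 3)" using 3 by simp
    then have m: "(cx p) ^ (n - 2) = m * cx p" by (simp add: m_def)
    have y: "ven n p = cy p + m * (cx p) ^ 3 * tt p"
      using 3 by (simp add: ven_def m_def flip: power_add)
    have "zeta n p = - cz p + m * tt p * (ven n p * eta p + (cx p)\<^sup>2 * ww p)"
      unfolding m_def by (rule zeta_ge_3[OF 3])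
    then have "cx p * zeta n p + tt p - ven n p * m * cx p * tt p * eta p = ven n p * ww p"
      using y t by algebra
    then have "ven n p * w_of n (ven n p) (cx p) (tt p) (xi1 n p) = ven n p * ww p"
      using v z 3 eta_of_xi1 m by (simp add: w_of_def lexp_def field_simps power2_eq_square)
    then show ?thesis using v by simp
  qed
qed

lemma z_of_xi1: "z_of n (ven n p) (cx p) (tt p) (xi1 n p) = cz p"
proof -
  have z: "zeta n p = ven n p ^ lexp n * xi1 n p" by (rule zeta_xi1[OF v])
  consider "n = 1" | "n = 2" | "n \<ge> 3" using n by linarith
  then show ?thesis
  proof cases
    case 1
    have "zeta 1 p = ven 1 p ^ 3 * xi1 1 p" using z 1 by (simp add: lexp_def)
    then have "tt p * (2 * ven 1 p * ww p + cx p * tt p * ww p + (tt p)\<^sup>2 * eta p) =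
        ven 1 p * (cz p + (ven 1 p)\<^sup>2 * xi1 1 p)"
      unfolding zeta_1 by algebra
    then show ?thesis using v 1 eta_of_xi1 w_of_xi1 by (simp add: z_of_def Let_def)
  next
    case 2
    then show ?thesis using z[symmetric] zeta_2[of p] eta_of_xi1 w_of_xi1
      by (simp add: z_of_def Let_def lexp_def)
  next
    case 3
    then show ?thesis using z[symmetric] zeta_ge_3[OF 3, of p] eta_of_xi1 w_of_xi1
      by (simp add: z_of_def Let_def lexp_def)
  qed
qed

lemma u_of_xi1: "u_of n (ven n p) (cx p) (tt p) (xi1 n p) = cu p"
proof -
  define r where "r = eta p + (tt p + cx p * cz p) * ww p"
  have r: "r = (cx p)\<^sup>2 * cu p" by (simp add: r_def eta_eq)
  have w: "ww p - (cz p)\<^sup>2 = cy p * cu p" by (simp add: ww_def)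
  show ?thesis
  proof (cases "n = 1")
    case True
    have y: "ven 1 p = cy p + cx p * tt p" by (simp add: ven_def)
    have "(ven 1 p + cx p * tt p) * (ww p - (cz p)\<^sup>2) + (tt p)\<^sup>2 * r = (ven 1 p)\<^sup>2 * cu p"
      using r w y by algebra
    then show ?thesis using True v eta_of_xi1 w_of_xi1 z_of_xi1
      by (simp add: u_of_def Let_def r_def)
  next
    case False
    define m where "m = (cx p) ^ (n - 2)"
    have "(cx p) ^ n = m * (cx p)\<^sup>2" unfolding m_def using n False by (intro power_split) simp
    then have y: "ven n p = cy p + m * (cx p)\<^sup>2 * tt p" by (simp add: ven_def)
    have "ww p - (cz p)\<^sup>2 + m * tt p * r = ven n p * cu p"
      using r w y by algebra
    then show ?thesis using False v eta_of_xi1 w_of_xi1 z_of_xi1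
      by (simp add: u_of_def Let_def r_def m_def)
  qed
qed

end

section \<open>The charts and the transition function\<close>

lemma quasi_affine_total_space: "quasi_affine total_space"
proof -
  have "{p. cx p = 0 \<and> cy p = 0} = {p. p $ 1 = 0} \<inter> {p. p $ 2 = 0}"
    by (auto simp: cx_def cy_def)
  then show ?thesis unfolding total_space_def
    by (auto intro!: quasi_affine_Compl zariski_closed_Int zariski_closed_zero poly_fun.coord)
qed

lemma quasi_affine_punctured_plane: "quasi_affine punctured_plane"
proof -
  have "{0 :: complex ^ 2} = {p. p $ 1 = 0} \<inter> {p. p $ 2 = 0}"
    by (auto simp: vec_eq_iff forall_2)
  then show ?thesis unfolding punctured_plane_def
    by (auto intro!: quasi_affine_Compl zariski_closed_Int zariski_closed_zero poly_fun.coord)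
qed

lemma vprod_U0: "vprod U0 (UNIV :: (complex ^ 'f) set) = {q. q $ Inl 2 \<noteq> 0}"
  by (simp add: vprod_UNIV U0_def)

lemma vprod_U1: "vprod U1 (UNIV :: (complex ^ 'f) set) = {q. q $ Inl 1 \<noteq> 0}"
  by (simp add: vprod_UNIV U1_def)

lemma vprod_U01:
  "vprod (U0 \<inter> U1) (UNIV :: (complex ^ 'f) set) = {q. q $ Inl 2 * q $ Inl 1 \<noteq> 0}"
  by (auto simp: vprod_UNIV U0_def U1_def)

text \<open>The condition \<open>f 0 = 0\<close> puts the origin into the removed zero set, so the
  complement formed in the whole plane already lies in the punctured plane.\<close>

lemma zariski_openin_punctured_plane:
  assumes "poly_fun f" "f 0 = 0"
  shows "zariski_openin punctured_plane {b. f b \<noteq> 0}"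
  unfolding zariski_openin_def punctured_plane_def
  using zariski_closed_zero[OF assms(1)] assms(2) by (intro exI[of _ "{b. f b = 0}"]) auto

lemma zariski_openin_U0: "zariski_openin punctured_plane U0"
  unfolding U0_def by (rule zariski_openin_punctured_plane) (auto intro: poly_fun.coord)

lemma zariski_openin_U1: "zariski_openin punctured_plane U1"
  unfolding U1_def by (rule zariski_openin_punctured_plane) (auto intro: poly_fun.coord)

lemma Phi_in_U0 [simp]: "Phi n p \<in> U0 \<longleftrightarrow> cx p \<noteq> 0"
  by (simp add: U0_def Phi_def)

lemma Phi_in_U1 [simp]: "Phi n p \<in> U1 \<longleftrightarrow> ven n p \<noteq> 0"
  by (simp add: U1_def Phi_def)

text \<open>On \<open>x = y = 0\<close> also \<open>t = 0\<close> and hence \<open>v = 0\<close>.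
  Preimages of \<open>U0\<close> and \<open>U1\<close> can therefore be taken in all of affine
  4-space.\<close>

lemma vimage_subset_total_space: "Phi n -` (U0 \<union> U1) \<subseteq> total_space"
  by (auto simp: total_space_def ven_def tt_def)

section \<open>Regularity of the bundle map and of the fiber coordinates\<close>

lemma poly_fun_coordinates:
  "poly_fun cx" "poly_fun cy" "poly_fun cz" "poly_fun cu" "poly_fun ww" "poly_fun tt"
  "poly_fun ss" "poly_fun eta" "poly_fun (ven n)"
proof -
  show c: "poly_fun cx" "poly_fun cy" "poly_fun cz" "poly_fun cu"
    using poly_fun.coord by (simp_all add: cx_def[abs_def] cy_def[abs_def] cz_def[abs_def] cu_def[abs_def])
  show w: "poly_fun ww" unfolding ww_def[abs_def] by (intro poly_fun_intros c)
  show t: "poly_fun tt" unfolding tt_def[abs_def] by (intro poly_fun_intros c w)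
  show s: "poly_fun ss" unfolding ss_def[abs_def] by (intro poly_fun_intros c w)
  show "poly_fun eta" unfolding eta_def[abs_def] by (intro poly_fun_intros c s)
  show "poly_fun (ven n)" unfolding ven_def[abs_def] by (intro poly_fun_intros c t)
qed

lemma poly_fun_zeta: "poly_fun (zeta n)"
proof -
  consider "n = 1" | "n = 2" | "n \<noteq> 1" "n \<noteq> 2" by blast
  then show ?thesis
    by cases (auto simp: zeta_def[abs_def] intro!: poly_fun_intros poly_fun_coordinates)
qed

lemma regular_on_Phi: "regular_on X (\<lambda>p. Phi n p $ i)"
  unfolding Phi_def by (intro regular_on_vector_2 regular_on_poly_fun poly_fun_coordinates)

lemma regular_on_phi0: "X \<subseteq> {p. cx p \<noteq> 0} \<Longrightarrow> regular_on X (\<lambda>p. phi0 p $ i)"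
  unfolding phi0_def xi0_def
  by (intro regular_on_vector_2 regular_on_divide regular_on_poly_fun poly_fun_coordinates
      poly_fun_power) auto

lemma regular_on_xi1:
  assumes "X \<subseteq> {p. ven n p \<noteq> 0}"
  shows "regular_on X (xi1 n)"
proof -
  have "regular_on X (\<lambda>p. zeta n p / ven n p ^ lexp n)"
    using assms by (intro regular_on_divide regular_on_poly_fun poly_fun_coordinates
        poly_fun_power poly_fun_zeta) auto
  then show ?thesis
    by (rule regular_on_cong) (simp add: xi1_def lexp_def)
qed

lemma regular_on_phi1: "X \<subseteq> {p. ven n p \<noteq> 0} \<Longrightarrow> regular_on X (\<lambda>p. phi1 n p $ i)"
  unfolding phi1_def
  by (intro regular_on_vector_2 regular_on_xi1 regular_on_poly_fun poly_fun_coordinates)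

lemma coordinates_vector [simp]:
  "cx (vector [x, y, z, u]) = x" "cy (vector [x, y, z, u]) = y"
  "cz (vector [x, y, z, u]) = z" "cu (vector [x, y, z, u]) = u"
  by (simp_all add: cx_def cy_def cz_def cu_def)

lemma vector_coordinates: "vector [cx p, cy p, cz p, cu p] = p"
  by (simp add: vec_eq_iff forall_4 cx_def cy_def cz_def cu_def)

text \<open>The assumptions are the defining relations of \<open>t\<close>, \<open>w\<close> and
  \<open>eta\<close>, the last in the form \<open>eta_eq\<close>. Both inverse charts construct a
  point from numbers with these relations, and this lemma evaluates the charts there.\<close>

lemma invariants_vector:
  assumes "x * z + y * w = t" "z\<^sup>2 + y * u = w" "x\<^sup>2 * u = e + (t + x * z) * w"
    and p: "p = vector [x, y, z, u]"
  shows "ww p = w" "tt p = t" "eta p = e" "ven n p = y + x ^ n * t"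
proof -
  show w: "ww p = w" using assms by (simp add: ww_def)
  then show t: "tt p = t" using assms by (simp add: tt_def)
  show "eta p = e" using w t assms by (simp add: eta_eq)
  show "ven n p = y + x ^ n * t" using t p by (simp add: ven_def)
qed

section \<open>The inverse maps of the two charts\<close>

definition chart0_inv :: "nat \<Rightarrow> complex ^ (2 + 2) \<Rightarrow> complex ^ 4" where
  "chart0_inv n q =
     (let v = q $ Inl 1; x = q $ Inl 2; t = q $ Inr 1; e = x ^ 3 * q $ Inr 2;
        y = v - x ^ n * t; w = (t\<^sup>2 + y * e) / x\<^sup>2; z = (t - y * w) / x
      in vector [x, y, z, (e + (t + x * z) * w) / x\<^sup>2])"

definition chart1_inv :: "nat \<Rightarrow> complex ^ (2 + 2) \<Rightarrow> complex ^ 4" where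
  "chart1_inv n q =
     (let v = q $ Inl 1; x = q $ Inl 2; t = q $ Inr 1; \<xi> = q $ Inr 2
      in vector [x, v - x ^ n * t, z_of n v x t \<xi>, u_of n v x t \<xi>])"

lemma chart0_inv_left:
  assumes "cx p \<noteq> 0"
  shows "chart0_inv n (vpair (Phi n p) (phi0 p)) = p"
proof -
  have y: "ven n p - (cx p) ^ n * tt p = cy p" by (simp add: ven_def)
  have e: "(cx p) ^ 3 * xi0 p = eta p" using assms by (simp add: xi0_def)
  have w: "((tt p)\<^sup>2 + cy p * eta p) / (cx p)\<^sup>2 = ww p"
    using assms ww_relation[of p] by (simp add: field_simps)
  have z: "(tt p - cy p * ww p) / cx p = cz p" using assms by (simp add: tt_def)
  have u: "(eta p + (tt p + cx p * cz p) * ww p) / (cx p)\<^sup>2 = cu p"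
    using assms by (simp add: eta_eq)
  show ?thesis
    unfolding chart0_inv_def Let_def
    by (simp add: Phi_def phi0_def y e w z u vector_coordinates)
qed

lemma chart0_inv_right:
  assumes "q $ Inl 2 \<noteq> 0"
  shows "vpair (Phi n (chart0_inv n q)) (phi0 (chart0_inv n q)) = q"
proof -
  define v x t e where "v = q $ Inl 1" and "x = q $ Inl 2" and "t = q $ Inr 1"
    and "e = x ^ 3 * q $ Inr 2"
  define y where "y = v - x ^ n * t"
  define w where "w = (t\<^sup>2 + y * e) / x\<^sup>2"
  define z where "z = (t - y * w) / x"
  define u where "u = (e + (t + x * z) * w) / x\<^sup>2"
  have x: "x \<noteq> 0" using assms by (simp add: x_def)
  have p: "chart0_inv n q = vector [x, y, z, u]"
    by (simp add: chart0_inv_def Let_def v_def x_def t_def e_def y_def w_def z_def u_def)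
  have w: "x\<^sup>2 * w = t\<^sup>2 + y * e" using x by (simp add: w_def)
  have z: "x * z + y * w = t" using x by (simp add: z_def)
  have u: "x\<^sup>2 * u = e + (t + x * z) * w" using x by (simp add: u_def)
  \<comment> \<open>Only the defining relation of \<open>w\<close> does not hold by construction.
    Multiplied by \<open>x^2\<close>, it reduces to \<open>t^2 + y e = x^2 w\<close>.\<close>
  have "x\<^sup>2 * (z\<^sup>2 + y * u) = x\<^sup>2 * w"
  proof -
    have "x\<^sup>2 * (z\<^sup>2 + y * u) = x\<^sup>2 * z\<^sup>2 + y * (x\<^sup>2 * u)" by (simp add: algebra_simps)
    also have "\<dots> = (x * z + y * w) * (t + x * z) + y * e - t * (x * z)"
      unfolding u by algebra
    also have "\<dots> = x\<^sup>2 * w" unfolding z w by algebra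
    finally show ?thesis .
  qed
  then have "z\<^sup>2 + y * u = w" using x by simp
  note i = invariants_vector[OF z this u p]
  have "Phi n (chart0_inv n q) = vector [v, x]" unfolding Phi_def i by (simp add: p y_def)
  moreover have "phi0 (chart0_inv n q) = vector [t, q $ Inr 2]"
    unfolding phi0_def xi0_def i using x by (simp add: p e_def)
  ultimately show ?thesis
    by (simp add: v_def x_def t_def vpair_def vec_eq_iff forall_2 split: sum.split)
qed

lemma chart1_inv_left:
  assumes "n \<ge> 1" "ven n p \<noteq> 0"
  shows "chart1_inv n (vpair (Phi n p) (phi1 n p)) = p"
proof -
  have y: "ven n p - (cx p) ^ n * tt p = cy p" by (simp add: ven_def)
  show ?thesis
    unfolding chart1_inv_def Let_def
    by (simp add: Phi_def phi1_def y z_of_xi1[OF assms] u_of_xi1[OF assms] vector_coordinates)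
qed

text \<open>The relations for the inverse formulas determine \<open>tt\<close>, \<open>ww\<close>,
  \<open>eta\<close> and \<open>ven\<close> at the constructed point; reading \<open>z_of\<close>
  backwards then gives \<open>zeta = v^l \<xi>\<close>, the prescribed last coordinate. The second
  conclusion places the point over \<open>U1\<close>.\<close>

lemma chart1_inv_right:
  assumes n: "n \<ge> 1" and "q $ Inl 1 \<noteq> 0"
  shows "vpair (Phi n (chart1_inv n q)) (phi1 n (chart1_inv n q)) = q"
    "ven n (chart1_inv n q) = q $ Inl 1"
proof -
  define v x t \<xi> where "v = q $ Inl 1" and "x = q $ Inl 2" and "t = q $ Inr 1" and "\<xi> = q $ Inr 2"
  let ?e = "eta_of n v x t \<xi>" and ?w = "w_of n v x t \<xi>" and ?z = "z_of n v x t \<xi>"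
  have v: "v \<noteq> 0" using assms by (simp add: v_def)
  have p: "chart1_inv n q = vector [x, v - x ^ n * t, ?z, u_of n v x t \<xi>]"
    by (simp add: chart1_inv_def Let_def v_def x_def t_def \<xi>_def)
  note i = invariants_vector[OF z_w_of_relations(1)[OF n v] u_of_relations[OF n v] p]
  have ven: "ven n (chart1_inv n q) = v" unfolding i by simp
  have c: "cx (chart1_inv n q) = x" "cz (chart1_inv n q) = ?z" by (simp_all add: p)
  consider "n = 1" | "n = 2" | "n \<ge> 3" using n by linarith
  then have "zeta n (chart1_inv n q) = v ^ lexp n * \<xi>"
  proof cases
    case 1
    have "v * ?z = - (v ^ 3 * \<xi>) + t * (2 * v * ?w + x * t * ?w + t\<^sup>2 * ?e)"
      using v 1 by (simp add: z_of_def Let_def field_simps power2_eq_square power3_eq_cube)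
    then show ?thesis using 1 i(1-3) c ven zeta_1[of "chart1_inv n q"] by (simp add: lexp_def)
  next
    case 2
    then show ?thesis using i(1-3) c ven zeta_2[of "chart1_inv n q"]
      by (simp add: lexp_def z_of_def Let_def)
  next
    case 3
    then show ?thesis using i(1-3) c ven zeta_ge_3[OF 3, of "chart1_inv n q"]
      by (simp add: lexp_def z_of_def Let_def)
  qed
  then have "xi1 n (chart1_inv n q) = \<xi>"
    using zeta_xi1[of n "chart1_inv n q"] ven v by simp
  then have "phi1 n (chart1_inv n q) = vector [t, \<xi>]" by (simp add: phi1_def i)
  moreover have "Phi n (chart1_inv n q) = vector [v, x]" unfolding Phi_def ven by (simp add: p)
  ultimately show "vpair (Phi n (chart1_inv n q)) (phi1 n (chart1_inv n q)) = q"
    by (simp add: v_def x_def t_def \<xi>_def vpair_def vec_eq_iff forall_2 split: sum.split)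
  show "ven n (chart1_inv n q) = q $ Inl 1" by (simp add: ven v_def)
qed

lemma regular_on_chart0_inv:
  assumes "X \<subseteq> {q. q $ Inl 2 \<noteq> 0}"
  shows "regular_on X (\<lambda>q. chart0_inv n q $ i)"
  unfolding chart0_inv_def Let_def using assms
  by (intro regular_on_vector_4 regular_on_intros) auto

lemma regular_on_pp:
  assumes "regular_on X v" "regular_on X x" "regular_on X t"
  shows "regular_on X (\<lambda>q. pp n (x q) (v q) (t q))"
proof -
  consider "n = 1" | "n = 2" | "n \<noteq> 1" "n \<noteq> 2" by blast
  then show ?thesis
    by cases (auto simp: pp_def intro!: regular_on_intros assms)
qed

context
  fixes X :: "(complex ^ 'n) set" and v x t \<xi> :: "complex ^ 'n \<Rightarrow> complex"
  assumes reg: "regular_on X v" "regular_on X x" "regular_on X t" "regular_on X \<xi>"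
    and nz: "\<And>q. q \<in> X \<Longrightarrow> v q \<noteq> 0"
begin

lemma regular_on_eta_of: "regular_on X (\<lambda>q. eta_of n (v q) (x q) (t q) (\<xi> q))"
  unfolding eta_of_def using nz by (intro regular_on_intros regular_on_pp reg) auto

lemma regular_on_w_of: "regular_on X (\<lambda>q. w_of n (v q) (x q) (t q) (\<xi> q))"
  unfolding w_of_def using nz
  by (cases "n = 1"; cases "n = 2") (simp_all, (intro regular_on_intros regular_on_eta_of reg; simp)+)

lemma regular_on_z_of: "regular_on X (\<lambda>q. z_of n (v q) (x q) (t q) (\<xi> q))"
  unfolding z_of_def Let_def using nz
  by (cases "n = 1"; cases "n = 2")
    (simp_all, (intro regular_on_intros regular_on_eta_of regular_on_w_of reg; simp)+)

lemma regular_on_u_of: "regular_on X (\<lambda>q. u_of n (v q) (x q) (t q) (\<xi> q))"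
  unfolding u_of_def Let_def using nz
  by (cases "n = 1")
    (simp_all, (intro regular_on_intros regular_on_eta_of regular_on_w_of regular_on_z_of reg; simp)+)

end

lemma regular_on_chart1_inv:
  assumes "X \<subseteq> {q. q $ Inl 1 \<noteq> 0}"
  shows "regular_on X (\<lambda>q. chart1_inv n q $ i)"
  unfolding chart1_inv_def Let_def using assms
  by (intro regular_on_vector_4 regular_on_z_of regular_on_u_of regular_on_intros) auto

section \<open>The charts as isomorphisms\<close>

text \<open>A general \<open>V\<close> serves two uses: \<open>U0\<close> for the trivialization,
  and \<open>U0 \<inter> U1\<close> for the transition function.\<close>

lemma variety_iso_chart0:
  assumes "V \<subseteq> U0" "quasi_affine (Phi n -` V)" "quasi_affine (vprod V (UNIV :: (complex ^ 2) set))"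
  shows "variety_iso (Phi n -` V) (vprod V (UNIV :: (complex ^ 2) set)) (\<lambda>p. vpair (Phi n p) (phi0 p))"
proof -
  have X: "Phi n -` V \<subseteq> {p. cx p \<noteq> 0}" using assms(1) by auto
  have Y: "vprod V (UNIV :: (complex ^ 2) set) \<subseteq> {q. q $ Inl 2 \<noteq> 0}"
    using assms(1) by (auto simp: vprod_UNIV U0_def)
  have "chart0_inv n q \<in> Phi n -` V" if "q \<in> vprod V UNIV" for q
  proof -
    have "vpair (Phi n (chart0_inv n q)) (phi0 (chart0_inv n q)) = q"
      using chart0_inv_right that Y by auto
    with that show ?thesis by (metis vimageI2 vpair_in_vprod_UNIV)
  qed
  then have "variety_morphism (vprod V UNIV) (Phi n -` V) (chart0_inv n)"
    using assms(2,3) regular_on_chart0_inv[OF Y] by (auto simp: variety_morphism_def)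
  moreover have "variety_morphism (Phi n -` V) (vprod V UNIV) (\<lambda>p. vpair (Phi n p) (phi0 p))"
    using assms(2,3) regular_on_vpair[OF regular_on_Phi regular_on_phi0[OF X]]
    by (auto simp: variety_morphism_def)
  ultimately show ?thesis
    using X Y chart0_inv_left chart0_inv_right by (intro variety_isoI) auto
qed

lemma variety_iso_chart1:
  assumes "n \<ge> 1"
  shows "variety_iso (Phi n -` U1) (vprod U1 (UNIV :: (complex ^ 2) set)) (\<lambda>p. vpair (Phi n p) (phi1 n p))"
proof -
  have X: "Phi n -` U1 = {p. ven n p \<noteq> 0}" by auto
  have qa: "quasi_affine (Phi n -` U1)" "quasi_affine (vprod U1 (UNIV :: (complex ^ 2) set))"
    unfolding X vprod_U1 by (intro quasi_affine_nonzero poly_fun_coordinates poly_fun.coord)+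
  then have "variety_morphism (vprod U1 UNIV) (Phi n -` U1) (chart1_inv n)"
    using chart1_inv_right(2)[OF assms] regular_on_chart1_inv
    by (auto simp: variety_morphism_def vprod_U1)
  moreover have "variety_morphism (Phi n -` U1) (vprod U1 UNIV) (\<lambda>p. vpair (Phi n p) (phi1 n p))"
    using qa regular_on_vpair[OF regular_on_Phi regular_on_phi1] X
    by (auto simp: variety_morphism_def)
  ultimately show ?thesis
    using X chart1_inv_left[OF assms] chart1_inv_right(1)[OF assms]
    by (intro variety_isoI) (auto simp: vprod_U1)
qed

section \<open>The transition function\<close>

lemma xi1_eq_xi0:
  assumes "n \<ge> 1" "cx p \<noteq> 0" "ven n p \<noteq> 0"
  shows "xi1 n p = xi0 p + pp n (cx p) (ven n p) (tt p) / ((cx p) ^ 3 * ven n p ^ lexp n)"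
proof -
  have "xi1 n p = zeta n p / ven n p ^ lexp n" using zeta_xi1[OF assms(3)] assms(3) by simp
  also have "zeta n p = (ven n p ^ lexp n * eta p + pp n (cx p) (ven n p) (tt p)) / (cx p) ^ 3"
    using zeta_transition[OF assms(1), of p] assms(2) by (simp add: field_simps)
  finally show ?thesis using assms(2,3) by (simp add: xi0_def add_divide_distrib)
qed

text \<open>The preimage of the given point under the first chart is explicit through
  \<open>chart0_inv\<close>. This resolves \<open>inv_into\<close>, and it remains to evaluate
  \<open>phi1\<close> there by \<open>xi1_eq_xi0\<close>.\<close>

lemma transition_function_phi:
  assumes n: "n \<ge> 1" and b: "b \<in> U0 \<inter> U1"
  shows "transition_function total_space (Phi n) (U0 \<inter> U1) phi0 (phi1 n) (vpair b (vector [\<tau>, \<sigma>])) =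
    vpair b (vector [\<tau>, \<sigma> + pp n (b $ 2) (b $ 1) \<tau> / ((b $ 2) ^ 3 * (b $ 1) ^ lexp n)])"
proof -
  have "Phi n -` (U0 \<inter> U1) = {p. cx p * ven n p \<noteq> 0}" by auto
  then have "quasi_affine (Phi n -` (U0 \<inter> U1))"
    by (simp only:) (intro quasi_affine_nonzero poly_fun.mult poly_fun_coordinates)
  moreover have "quasi_affine (vprod (U0 \<inter> U1) (UNIV :: (complex ^ 2) set))"
    unfolding vprod_U01 by (intro quasi_affine_nonzero poly_fun.mult poly_fun.coord)
  moreover have E: "total_space \<inter> Phi n -` (U0 \<inter> U1) = Phi n -` (U0 \<inter> U1)"
    using vimage_subset_total_space[of n] by auto
  ultimately have iso: "variety_iso (total_space \<inter> Phi n -` (U0 \<inter> U1))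
      (vprod (U0 \<inter> U1) (UNIV :: (complex ^ 2) set)) (\<lambda>p. vpair (Phi n p) (phi0 p))"
    using variety_iso_chart0[of "U0 \<inter> U1" n] by simp
  define p where "p = chart0_inv n (vpair b (vector [\<tau>, \<sigma>]))"
  have "vpair (Phi n p) (phi0 p) = vpair b (vector [\<tau>, \<sigma>])"
    using b unfolding p_def by (intro chart0_inv_right) (simp add: U0_def)
  then have Phi: "Phi n p = b" and phi0: "phi0 p = vector [\<tau>, \<sigma>]" by simp_all
  have p: "ven n p = b $ 1" "cx p = b $ 2" "tt p = \<tau>" "xi0 p = \<sigma>"
    using Phi phi0 by (auto simp: Phi_def phi0_def vector_2_eq_iff)
  have nz: "cx p \<noteq> 0" "ven n p \<noteq> 0" using b p by (simp_all add: U0_def U1_def)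
  have "p \<in> total_space" using E b Phi by blast
  then have "transition_function total_space (Phi n) (U0 \<inter> U1) phi0 (phi1 n) (vpair b (vector [\<tau>, \<sigma>])) =
      vpair b (phi1 n p)"
    using transition_function_vpair[OF iso, of p "phi1 n"] b Phi phi0 by simp
  then show ?thesis using xi1_eq_xi0[OF n nz] by (simp add: phi1_def p)
qed

lemma triangular_transition_function:
  assumes "n \<ge> 1"
  shows "triangular_automorphism (U0 \<inter> U1)
    (transition_function total_space (Phi n) (U0 \<inter> U1) phi0 (phi1 n))"
proof (rule triangular_automorphism_shear)
  show "quasi_affine (vprod (U0 \<inter> U1) (UNIV :: (complex ^ 2) set))"
    unfolding vprod_U01 by (intro quasi_affine_nonzero poly_fun.mult poly_fun.coord)
  let ?h = "\<lambda>b \<tau>. pp n (b $ 2) (b $ 1) \<tau> / ((b $ 2) ^ 3 * (b $ 1) ^ lexp n)"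
  show "transition_function total_space (Phi n) (U0 \<inter> U1) phi0 (phi1 n) (vpair b (vector [\<tau>, \<sigma>])) =
      vpair b (vector [\<tau>, \<sigma> + ?h b \<tau>])" if "b \<in> U0 \<inter> U1" for b \<tau> \<sigma>
    using transition_function_phi[OF assms that] .
  show "regular_on (vprod (U0 \<inter> U1) (UNIV :: (complex ^ 2) set)) (\<lambda>q. ?h (\<chi> i. q $ Inl i) (q $ Inr 1))"
    "regular_on (vprod (U0 \<inter> U1) (UNIV :: (complex ^ 1) set)) (\<lambda>q. ?h (\<chi> i. q $ Inl i) (q $ Inr 1))"
    by (simp_all, (intro regular_on_divide regular_on_pp regular_on_mult regular_on_power
          regular_on_coord; simp add: vprod_U01)+)
qed

theorem proposition2:
  fixes n k l :: nat
  assumes "n \<ge> 1"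
    and "(k, l) = (if n \<ge> 2 then (3, 2) else (3, 3))"
  shows
    "local_trivialization total_space punctured_plane (Phi n) (UNIV :: (complex ^ 2) set) U0 phi0 \<and>
     local_trivialization total_space punctured_plane (Phi n) (UNIV :: (complex ^ 2) set) U1 (phi1 n) \<and>
     variety_iso (Phi n -` U0) (vprod U0 (UNIV :: (complex ^ 2) set)) (\<lambda>p. vpair (Phi n p) (phi0 p)) \<and>
     variety_iso (Phi n -` U1) (vprod U1 (UNIV :: (complex ^ 2) set)) (\<lambda>p. vpair (Phi n p) (phi1 n p)) \<and>
     algebraic_fiber_bundle total_space punctured_plane (Phi n) (UNIV :: (complex ^ 2) set) \<and>
     triangular_automorphism (U0 \<inter> U1)
       (transition_function total_space (Phi n) (U0 \<inter> U1) phi0 (phi1 n)) \<and>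
     (\<forall>b \<in> U0 \<inter> U1. \<forall>\<tau> \<sigma>.
        transition_function total_space (Phi n) (U0 \<inter> U1) phi0 (phi1 n) (vpair b (vector [\<tau>, \<sigma>])) =
        vpair b (vector [\<tau>, \<sigma> + pp n (b $ 2) (b $ 1) \<tau> / ((b $ 2)^k * (b $ 1)^l)])) \<and>
     (\<forall>p \<in> Phi n -` (U0 \<inter> U1).
        xi1 n p = xi0 p + pp n (cx p) (ven n p) (tt p) / ((cx p)^k * (ven n p)^l))"
proof -
  \<comment> \<open>Given \<open>n \<ge> 1\<close>, the failure of \<open>n \<ge> 2\<close> means
    \<open>n = 1\<close>, which is the case distinction in \<open>lexp\<close>.\<close>
  have k: "k = 3" and l: "l = lexp n" using assms by (auto simp: lexp_def split: if_splits)
  have iso0: "variety_iso (Phi n -` U0) (vprod U0 (UNIV :: (complex ^ 2) set)) (\<lambda>p. vpair (Phi n p) (phi0 p))"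
  proof (rule variety_iso_chart0)
    have "Phi n -` U0 = {p. cx p \<noteq> 0}" by auto
    then show "quasi_affine (Phi n -` U0)"
      by (simp only:) (intro quasi_affine_nonzero poly_fun_coordinates)
    show "quasi_affine (vprod U0 (UNIV :: (complex ^ 2) set))"
      unfolding vprod_U0 by (intro quasi_affine_nonzero poly_fun.coord)
  qed simp
  note iso1 = variety_iso_chart1[OF assms(1)]
  have E: "total_space \<inter> Phi n -` U0 = Phi n -` U0" "total_space \<inter> Phi n -` U1 = Phi n -` U1"
    using vimage_subset_total_space[of n] by auto
  have triv: "local_trivialization total_space punctured_plane (Phi n) (UNIV :: (complex ^ 2) set) U0 phi0"
    "local_trivialization total_space punctured_plane (Phi n) (UNIV :: (complex ^ 2) set) U1 (phi1 n)"
    using iso0 iso1 zariski_openin_U0 zariski_openin_U1 by (simp_all add: local_trivialization_def E)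
  have "Phi n p \<in> punctured_plane" if "p \<in> total_space" for p
  proof -
    have "Phi n p \<noteq> 0"
    proof
      assume "Phi n p = 0"
      then have "ven n p = 0" "cx p = 0" by (auto simp: Phi_def vec_eq_iff forall_2)
      \<comment> \<open>At \<open>x = 0\<close> the summand \<open>x^n t\<close> of \<open>v\<close>
        vanishes because \<open>n \<ge> 1\<close>, so \<open>v = y\<close>. Hence the fiber over the
        origin lies in the plane removed from the total space.\<close>
      then have "cy p = 0" using assms(1) by (simp add: ven_def power_0_left)
      with \<open>cx p = 0\<close> that show False by (simp add: total_space_def)
    qed
    then show ?thesis by (simp add: punctured_plane_def)
  qed
  then have "variety_morphism total_space punctured_plane (Phi n)"
    using quasi_affine_total_space quasi_affine_punctured_plane regular_on_Phi
    by (auto simp: variety_morphism_def)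
  moreover have "\<exists>V \<phi>. b \<in> V \<and>
      local_trivialization total_space punctured_plane (Phi n) (UNIV :: (complex ^ 2) set) V \<phi>"
    if "b \<in> punctured_plane" for b
  proof -
    have "b \<in> U0 \<or> b \<in> U1"
      using that by (auto simp: punctured_plane_def U0_def U1_def vec_eq_iff forall_2)
    then show ?thesis using triv by metis
  qed
  ultimately have fib:
    "algebraic_fiber_bundle total_space punctured_plane (Phi n) (UNIV :: (complex ^ 2) set)"
    by (simp add: algebraic_fiber_bundle_def)
  have xi: "xi1 n p = xi0 p + pp n (cx p) (ven n p) (tt p) / ((cx p) ^ 3 * (ven n p) ^ lexp n)"
    if "p \<in> Phi n -` (U0 \<inter> U1)" for p
    using xi1_eq_xi0[OF assms(1), of p] that by simp
  show ?thesis
    unfolding k l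
    by (intro conjI ballI allI triv iso0 iso1 fib triangular_transition_function
        transition_function_phi xi assms(1))
qed

end
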